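(* Let $\mathcal{X}_\bullet$ be a measurable space, $n\ge1$, $\mathcal{X}=(\mathcal{X}_\bullet)^n$, $\mathcal{Y}=\{0,1\}^n$. Let $\vec{\mathcal{F}}$ be the set of probability distributions $P$ for $(X,Y)=((X_1,\dots,X_n),(Y_1,\dots,Y_n))$ on $\mathcal{X}\times\mathcal{Y}$ such that (i) for each $i$, $Y_i$ is conditionally independent of $X$ given $X_i$, and (ii) the conditional distribution of $Y_i\mid X_i$ is the same for all $i$ (i.e. there is one Markov kernel from $\mathcal{X}_\bullet$ to $\{0,1\}$ that is a version of the conditional distribution of $Y_i$ given $X_i$ for every $i$). Let $\mathcal{F}$ be a family of distributions on $\mathcal{Y}$ and let $s:\mathcal{Y}\times[0,1]^n\to\mathbb{R}$ be any $M$-proper scoring function for $\mathcal{F}$. If for the distributions $P\in\vec{\mathcal{F}}$ the conditional distributions $P_{Y\mid X=x}$, $x\in\mathcal{X}$, are in $\mathcal{F}$, then $\vec s$ is an $\vec M$-proper scoring function for $\vec{\mathcal{F}}$ with prediction space the set of coordinate-wise mappings.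
   Context: The marginal functional is $M(P)=\mathbb{E}_P[Y]=(P[Y_1=1],\dots,P[Y_n=1])\in[0,1]^n$. A scoring function $s:\mathcal{Y}\times[0,1]^n\to\mathbb{R}$ is $M$-proper for $\mathcal{F}$ if $\mathbb{E}_P[s(Y,u)]\le\mathbb{E}_P[s(Y,M(P))]$ for all $P\in\mathcal{F}$, $u\in[0,1]^n$. For a mapping $f:\mathcal{X}\to[0,1]^n$, the mapping form of $s$ is $\vec s((x,y),f)=s(y,f(x))$. The mapping functional is $\vec M(P)(x)=M(P_{Y\mid X=x})$, where $\{P_{Y\mid X=x}\}_x$ is a version of the conditional distributions of $Y$ given $X=x$ under $P$; $\vec M(P)$ is understood up to almost sure equality with respect to the law of $X$. A mapping $f$ is coordinate-wise if $f(x)=(f_\bullet(x_1),\dots,f_\bullet(x_n))$ for a single function $f_\bullet:\mathcal{X}_\bullet\to[0,1]$. "$\vec s$ is $\vec M$-proper for $\vec{\mathcal{F}}$ with prediction space the coordinate-wise mappings" means: for every $P\in\vec{\mathcal{F}}$, $\vec M(P)$ is (up to almost sure equality) a coordinate-wise mapping, and for every coordinate-wise mapping $f$, $\mathbb{E}_P[\vec s((X,Y),f)]\le\mathbb{E}_P[\vec s((X,Y),\vec M(P))]$, the inequality being understood whenever the two random variables involved are measurable and integrable. *)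

theory Defs
  imports "HOL-Probability.Probability"
begin

(* Vectors of length n are functions on the index set {..<n}, extended by
   undefined outside it, so that vectors agreeing on {..<n} are equal. *)

definition outcomes :: "nat \<Rightarrow> (nat \<Rightarrow> real) measure" where
  "outcomes n = count_space ({..<n} \<rightarrow>\<^sub>E {0, 1})"

definition unit_cube :: "nat \<Rightarrow> (nat \<Rightarrow> real) set" where
  "unit_cube n = ({..<n} \<rightarrow>\<^sub>E {0..1})"

definition features :: "nat \<Rightarrow> 'a measure \<Rightarrow> (nat \<Rightarrow> 'a) measure" where
  "features n M = (\<Pi>\<^sub>M i\<in>{..<n}. M)"

definition regular_cond_distr ::
  "'w measure \<Rightarrow> 'a measure \<Rightarrow> ('w \<Rightarrow> 'a) \<Rightarrow> 'b measure \<Rightarrow> ('w \<Rightarrow> 'b) \<Rightarrow> ('a \<Rightarrow> 'b measure) \<Rightarrow> bool"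
  \<comment> \<open>the Markov kernel \<open>K\<close> is a version of the conditional distribution of \<open>V\<close> given \<open>U\<close>\<close>
where
  "regular_cond_distr P A U B V K \<longleftrightarrow>
     U \<in> P \<rightarrow>\<^sub>M A \<and> V \<in> P \<rightarrow>\<^sub>M B \<and> K \<in> A \<rightarrow>\<^sub>M prob_algebra B \<and>
     (\<forall>S\<in>sets A. \<forall>T\<in>sets B.
        emeasure P {\<omega>\<in>space P. U \<omega> \<in> S \<and> V \<omega> \<in> T} = (\<integral>\<^sup>+x\<in>S. emeasure (K x) T \<partial>distr P A U))"

definition cond_prob_given ::
  "'w measure \<Rightarrow> 'c measure \<Rightarrow> ('w \<Rightarrow> 'c) \<Rightarrow> 'w set \<Rightarrow> 'w \<Rightarrow> real"
  \<comment> \<open>a version of the conditional probability of \<open>E\<close> given the \<open>\<sigma>\<close>-algebra generated by \<open>W\<close>\<close>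
where
  "cond_prob_given P C W E = real_cond_exp P (vimage_algebra (space P) W C) (indicator E)"

definition cond_indep ::
  "'w measure \<Rightarrow> 'a measure \<Rightarrow> ('w \<Rightarrow> 'a) \<Rightarrow> 'b measure \<Rightarrow> ('w \<Rightarrow> 'b) \<Rightarrow> 'c measure \<Rightarrow> ('w \<Rightarrow> 'c) \<Rightarrow> bool"
  \<comment> \<open>\<open>U\<close> and \<open>V\<close> are conditionally independent given \<open>W\<close>\<close>
where
  "cond_indep P A U B V C W \<longleftrightarrow>
     U \<in> P \<rightarrow>\<^sub>M A \<and> V \<in> P \<rightarrow>\<^sub>M B \<and> W \<in> P \<rightarrow>\<^sub>M C \<and>
     (\<forall>S\<in>sets A. \<forall>T\<in>sets B. AE \<omega> in P.
        cond_prob_given P C W {\<omega>\<in>space P. U \<omega> \<in> S \<and> V \<omega> \<in> T} \<omega> =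
        cond_prob_given P C W {\<omega>\<in>space P. U \<omega> \<in> S} \<omega> *
        cond_prob_given P C W {\<omega>\<in>space P. V \<omega> \<in> T} \<omega>)"

definition coordinate_family ::
  "nat \<Rightarrow> 'a measure \<Rightarrow> ((nat \<Rightarrow> 'a) \<times> (nat \<Rightarrow> real)) measure set" where
  "coordinate_family n M =
     {P \<in> space (prob_algebra (features n M \<Otimes>\<^sub>M outcomes n)).
        (\<forall>i<n. cond_indep P (count_space {0, 1}) (\<lambda>(x, y). y i) (features n M) fst
                 M (\<lambda>(x, y). x i)) \<and>
        (\<exists>K. \<forall>i<n. regular_cond_distr P M (\<lambda>(x, y). x i) (count_space {0, 1}) (\<lambda>(x, y). y i) K)}"

definition marginals :: "nat \<Rightarrow> (nat \<Rightarrow> real) measure \<Rightarrow> nat \<Rightarrow> real" where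
  "marginals n Q = (\<lambda>i\<in>{..<n}. \<integral>y. y i \<partial>Q)"

definition marginals_proper ::
  "nat \<Rightarrow> (nat \<Rightarrow> real) measure set \<Rightarrow> ((nat \<Rightarrow> real) \<Rightarrow> (nat \<Rightarrow> real) \<Rightarrow> real) \<Rightarrow> bool" where
  "marginals_proper n F s \<longleftrightarrow>
     (\<forall>Q\<in>F. \<forall>u\<in>unit_cube n. (\<integral>y. s y u \<partial>Q) \<le> (\<integral>y. s y (marginals n Q) \<partial>Q))"

definition mapping_form :: "('y \<Rightarrow> 'u \<Rightarrow> real) \<Rightarrow> 'x \<times> 'y \<Rightarrow> ('x \<Rightarrow> 'u) \<Rightarrow> real" where
  "mapping_form s = (\<lambda>(x, y) f. s y (f x))"

(* The mapping functional is determined only up to almost sure equality, so its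
   value is the set of all mappings representing it. *)
definition mapping_marginals ::
  "nat \<Rightarrow> 'a measure \<Rightarrow> ((nat \<Rightarrow> 'a) \<times> (nat \<Rightarrow> real)) measure \<Rightarrow> ((nat \<Rightarrow> 'a) \<Rightarrow> nat \<Rightarrow> real) set" where
  "mapping_marginals n M P =
     {g \<in> space (features n M) \<rightarrow> unit_cube n.
        \<exists>K. regular_cond_distr P (features n M) fst (outcomes n) snd K \<and>
            (AE x in distr P (features n M) fst. g x = marginals n (K x))}"

definition coordinate_wise :: "nat \<Rightarrow> 'a measure \<Rightarrow> ((nat \<Rightarrow> 'a) \<Rightarrow> nat \<Rightarrow> real) set" where
  "coordinate_wise n M =
     {f. \<exists>h \<in> space M \<rightarrow> {0..1}. \<forall>x\<in>space (features n M). f x = (\<lambda>i\<in>{..<n}. h (x i))}"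

(* FF is the family of joint distributions and G the prediction space. *)
definition mapping_marginals_proper ::
  "nat \<Rightarrow> 'a measure \<Rightarrow> ((nat \<Rightarrow> 'a) \<times> (nat \<Rightarrow> real)) measure set \<Rightarrow>
   ((nat \<Rightarrow> 'a) \<Rightarrow> nat \<Rightarrow> real) set \<Rightarrow>
   ((nat \<Rightarrow> 'a) \<times> (nat \<Rightarrow> real) \<Rightarrow> ((nat \<Rightarrow> 'a) \<Rightarrow> nat \<Rightarrow> real) \<Rightarrow> real) \<Rightarrow> bool" where
  "mapping_marginals_proper n M FF G S \<longleftrightarrow>
     (\<forall>P\<in>FF.
        mapping_marginals n M P \<inter> G \<noteq> {} \<and>
        (\<forall>g\<in>mapping_marginals n M P. \<forall>f\<in>G.
           integrable P (\<lambda>\<omega>. S \<omega> f) \<longrightarrow> integrable P (\<lambda>\<omega>. S \<omega> g) \<longrightarrow>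
           (\<integral>\<omega>. S \<omega> f \<partial>P) \<le> (\<integral>\<omega>. S \<omega> g \<partial>P)))"

end

theory Submission
  imports Defs
begin

text \<open>
  Conditional independence gives \<open>P(Y\<^sub>i = 1 | X) = P(Y\<^sub>i = 1 | X\<^sub>i) = h(X\<^sub>i)\<close> almost surely, where \<open>h\<close> does
  not depend on \<open>i\<close> because the kernel is common to all coordinates. So every version of the
  mapping functional is almost surely the coordinate-wise mapping induced by \<open>h\<close>. Disintegrating
  \<open>P\<close> along \<open>X\<close> then reduces the inequality of expectations to propriety of \<open>s\<close> for each
  conditional distribution.
\<close>

section \<open>Regular conditional distributions: real form, uniqueness, images\<close>

text \<open>The definition uses extended nonnegative integrals over the law of \<open>U\<close>,
  whereas conditional expectations are handled by real integrals over \<open>P\<close>. The two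
  agree because kernel values are probabilities, so every integrand is bounded by 1 and hence
  integrable.\<close>

lemma regular_cond_distr_iff_real:
  assumes "prob_space P" and U[measurable]: "U \<in> P \<rightarrow>\<^sub>M A" and V[measurable]: "V \<in> P \<rightarrow>\<^sub>M B"
    and K[measurable]: "K \<in> A \<rightarrow>\<^sub>M prob_algebra B"
  shows "regular_cond_distr P A U B V K \<longleftrightarrow>
    (\<forall>S\<in>sets A. \<forall>T\<in>sets B. measure P {\<omega>\<in>space P. U \<omega> \<in> S \<and> V \<omega> \<in> T} =
       (\<integral>\<omega>. indicator S (U \<omega>) * measure (K (U \<omega>)) T \<partial>P))"
proof -
  interpret prob_space P by fact
  have "emeasure P {\<omega>\<in>space P. U \<omega> \<in> S \<and> V \<omega> \<in> T} =
          (\<integral>\<^sup>+x\<in>S. emeasure (K x) T \<partial>distr P A U) \<longleftrightarrow>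
        measure P {\<omega>\<in>space P. U \<omega> \<in> S \<and> V \<omega> \<in> T} =
          (\<integral>\<omega>. indicator S (U \<omega>) * measure (K (U \<omega>)) T \<partial>P)" (is "_ \<longleftrightarrow> _ = ?I")
    if [measurable]: "S \<in> sets A" "T \<in> sets B" for S T
  proof -
    have prob: "prob_space (K x)" if "x \<in> space A" for x
      using measurable_space[OF K that] by (simp add: space_prob_algebra)
    have bound: "norm (indicator S (U \<omega>) * measure (K (U \<omega>)) T) \<le> 1" if "\<omega> \<in> space P" for \<omega>
      using prob_space.prob_le_1[OF prob[OF measurable_space[OF U that]]]
      by (auto simp: indicator_def)
    have int: "integrable P (\<lambda>\<omega>. indicator S (U \<omega>) * measure (K (U \<omega>)) T :: real)"
      by (rule integrable_const_bound[where B=1]) (use bound in auto)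
    have "(\<integral>\<^sup>+x\<in>S. emeasure (K x) T \<partial>distr P A U) =
        (\<integral>\<^sup>+x\<in>S. ennreal (measure (K x) T) \<partial>distr P A U)"
      by (rule nn_integral_cong)
        (simp add: finite_measure.emeasure_eq_measure prob prob_space.finite_measure)
    also have "\<dots> = (\<integral>\<^sup>+\<omega>. ennreal (measure (K (U \<omega>)) T) * indicator S (U \<omega>) \<partial>P)"
      by (subst nn_integral_distr) simp_all
    also have "\<dots> = (\<integral>\<^sup>+\<omega>. ennreal (indicator S (U \<omega>) * measure (K (U \<omega>)) T) \<partial>P)"
      by (rule nn_integral_cong) (simp add: indicator_def)
    also have "\<dots> = ennreal ?I"
      by (rule nn_integral_eq_integral[OF int]) simp
    finally show ?thesis
      by (simp add: emeasure_eq_measure)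
  qed
  then show ?thesis
    unfolding regular_cond_distr_def by (simp add: U V K)
qed

text \<open>For fixed \<open>T\<close>, both kernels integrate over every set \<open>S\<close> to
  the same joint probability, so they are densities of one measure with respect to the law of
  \<open>U\<close>. The exceptional set may depend on \<open>T\<close>; a single \<open>T\<close> is
  enough later, since a law on {0, 1} is determined by its mass at 1.\<close>

lemma regular_cond_distr_unique:
  assumes "prob_space P" and K: "regular_cond_distr P A U B V K"
    and K': "regular_cond_distr P A U B V K'" and T[measurable]: "T \<in> sets B"
  shows "AE x in distr P A U. measure (K x) T = measure (K' x) T"
proof -
  have [measurable]: "U \<in> P \<rightarrow>\<^sub>M A" and K_meas: "K \<in> A \<rightarrow>\<^sub>M prob_algebra B"
    and K'_meas: "K' \<in> A \<rightarrow>\<^sub>M prob_algebra B"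
    using K K' by (simp_all add: regular_cond_distr_def)
  interpret D: prob_space "distr P A U"
    by (rule prob_space.prob_space_distr) fact+
  have eq: "(\<integral>\<^sup>+x\<in>S. emeasure (L x) T \<partial>distr P A U) = emeasure P {\<omega>\<in>space P. U \<omega> \<in> S \<and> V \<omega> \<in> T}"
    if "regular_cond_distr P A U B V L" "S \<in> sets A" for L S
    using that T by (simp add: regular_cond_distr_def)
  have "AE x in distr P A U. emeasure (K x) T = emeasure (K' x) T"
  proof (rule D.density_unique2)
    show "(\<lambda>x. emeasure (K x) T) \<in> borel_measurable (distr P A U)"
      "(\<lambda>x. emeasure (K' x) T) \<in> borel_measurable (distr P A U)"
      using measurable_emeasure_kernel[OF measurable_prob_algebraD[OF K_meas] T]
        measurable_emeasure_kernel[OF measurable_prob_algebraD[OF K'_meas] T] by simp_all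
    show "(\<integral>\<^sup>+x\<in>S. emeasure (K x) T \<partial>distr P A U) = (\<integral>\<^sup>+x\<in>S. emeasure (K' x) T \<partial>distr P A U)"
      if "S \<in> sets (distr P A U)" for S
      using that eq[OF K] eq[OF K'] by simp
  qed
  then show ?thesis
    by eventually_elim (simp add: measure_def)
qed

text \<open>Preimages under \<open>g\<close> reduce events about \<open>g (V \<omega>)\<close> to
  events about \<open>V\<close>. This serves to pass from a kernel for the whole outcome vector to
  one for a single coordinate.\<close>

lemma regular_cond_distr_map:
  assumes K: "regular_cond_distr P A U B V K" and g[measurable]: "g \<in> B \<rightarrow>\<^sub>M C"
  shows "regular_cond_distr P A U C (\<lambda>\<omega>. g (V \<omega>)) (\<lambda>x. distr (K x) C g)"
proof -
  have [measurable]: "U \<in> P \<rightarrow>\<^sub>M A" "V \<in> P \<rightarrow>\<^sub>M B" "K \<in> A \<rightarrow>\<^sub>M prob_algebra B"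
    and eq: "\<And>S T. S \<in> sets A \<Longrightarrow> T \<in> sets B \<Longrightarrow>
      emeasure P {\<omega>\<in>space P. U \<omega> \<in> S \<and> V \<omega> \<in> T} = (\<integral>\<^sup>+x\<in>S. emeasure (K x) T \<partial>distr P A U)"
    using K by (simp_all add: regular_cond_distr_def)
  have "emeasure P {\<omega>\<in>space P. U \<omega> \<in> S \<and> g (V \<omega>) \<in> T} =
      (\<integral>\<^sup>+x\<in>S. emeasure (distr (K x) C g) T \<partial>distr P A U)"
    if S: "S \<in> sets A" and T[measurable]: "T \<in> sets C" for S T
  proof -
    have sets_K: "sets (K x) = sets B" if "x \<in> space A" for x
      using measurable_space[OF \<open>K \<in> _\<close> that] by (simp add: space_prob_algebra)
    have "{\<omega>\<in>space P. U \<omega> \<in> S \<and> g (V \<omega>) \<in> T} = {\<omega>\<in>space P. U \<omega> \<in> S \<and> V \<omega> \<in> g -` T \<inter> space B}"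
      using measurable_space[OF \<open>V \<in> _\<close>] by auto
    moreover have "emeasure (distr (K x) C g) T = emeasure (K x) (g -` T \<inter> space B)"
      if "x \<in> space A" for x
      using sets_K[OF that] sets_eq_imp_space_eq[OF sets_K[OF that]] g T
      by (subst emeasure_distr) (simp_all cong: measurable_cong_sets)
    ultimately show ?thesis
      using eq[OF S measurable_sets[OF g T]] by (auto intro!: nn_integral_cong)
  qed
  then show ?thesis
    using measurable_compose[OF \<open>K \<in> _\<close> measurable_distr_prob_space[OF g]]
    by (simp add: regular_cond_distr_def)
qed

section \<open>Conditional probability and conditional independence in terms of kernels\<close>

text \<open>The value of \<open>k\<close> at \<open>W\<close> is measurable for the sigma-algebra
  generated by \<open>W\<close>. That sigma-algebra consists of the preimages of sets
  \<open>S\<close> under \<open>W\<close>, so the averaging property that characterises a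
  conditional expectation is exactly the defining identity of the kernel.\<close>

lemma cond_prob_given_eq_kernel:
  assumes "prob_space P" and k: "regular_cond_distr P C W A U k" and T[measurable]: "T \<in> sets A"
  shows "AE \<omega> in P. cond_prob_given P C W {\<omega>\<in>space P. U \<omega> \<in> T} \<omega> = measure (k (W \<omega>)) T"
proof -
  interpret prob_space P by fact
  have W[measurable]: "W \<in> P \<rightarrow>\<^sub>M C" and U[measurable]: "U \<in> P \<rightarrow>\<^sub>M A"
    and k_meas[measurable]: "k \<in> C \<rightarrow>\<^sub>M prob_algebra A"
    using k by (simp_all add: regular_cond_distr_def)
  let ?F = "vimage_algebra (space P) W C"
  have W_fun: "W \<in> space P \<rightarrow> space C"
    using measurable_space[OF W] by auto
  have sub: "subalgebra P ?F"
    unfolding subalgebra_def sets_vimage_algebra2[OF W_fun]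
    by (auto intro: measurable_sets[OF W])
  interpret S: finite_measure_subalgebra P ?F
    by unfold_locales (rule sub)
  have W': "W \<in> ?F \<rightarrow>\<^sub>M C"
    by (rule measurable_vimage_algebra1[OF W_fun])
  have bound: "norm (measure (k (W \<omega>)) T) \<le> 1" if "\<omega> \<in> space P" for \<omega>
    using measurable_space[OF k_meas, of "W \<omega>"] W_fun that
    by (auto simp: space_prob_algebra intro: prob_space.prob_le_1)
  show ?thesis
    unfolding cond_prob_given_def
  proof (rule S.real_cond_exp_charact)
    show "integrable P (indicator {\<omega> \<in> space P. U \<omega> \<in> T} :: _ \<Rightarrow> real)"
      by (rule integrable_const_bound[where B=1]) auto
    show "integrable P (\<lambda>\<omega>. measure (k (W \<omega>)) T)"
      by (rule integrable_const_bound[where B=1]) (use bound in auto)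
    show "(\<lambda>\<omega>. measure (k (W \<omega>)) T) \<in> borel_measurable ?F"
      using measurable_compose[OF W', of "\<lambda>x. measure (k x) T" borel] by simp
  next
    fix E assume "E \<in> sets ?F"
    then obtain S where S[measurable]: "S \<in> sets C" and E: "E = W -` S \<inter> space P"
      using sets_vimage_algebra2[OF W_fun] by auto
    have "(LINT \<omega>:E|P. indicator {\<omega> \<in> space P. U \<omega> \<in> T} \<omega>) =
        (\<integral>\<omega>. indicator {\<omega>\<in>space P. W \<omega> \<in> S \<and> U \<omega> \<in> T} \<omega> \<partial>P :: real)"
      unfolding set_lebesgue_integral_def E
      by (rule Bochner_Integration.integral_cong) (auto simp: indicator_def)
    also have "\<dots> = measure P {\<omega>\<in>space P. W \<omega> \<in> S \<and> U \<omega> \<in> T}"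
      by (simp add: Int_absorb2 Collect_restrict)
    also have "\<dots> = (\<integral>\<omega>. indicator S (W \<omega>) * measure (k (W \<omega>)) T \<partial>P)"
      using k regular_cond_distr_iff_real[OF \<open>prob_space P\<close> W U k_meas] S T by blast
    also have "\<dots> = (LINT \<omega>:E|P. measure (k (W \<omega>)) T)"
      unfolding set_lebesgue_integral_def E
      by (rule Bochner_Integration.integral_cong) (auto simp: indicator_def)
    finally show "(LINT \<omega>:E|P. indicator {\<omega> \<in> space P. U \<omega> \<in> T} \<omega>) =
        (LINT \<omega>:E|P. measure (k (W \<omega>)) T)" .
  qed
qed

text \<open>Given \<open>w (V \<omega>)\<close>, the full \<open>V\<close> carries no further
  information on \<open>U\<close>, so the kernel for the coarser variable also serves for
  \<open>V\<close>. To see this, average the factorised conditional probability of the joint event,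
  with the factor for \<open>U\<close> replaced by the kernel, and undo the conditioning in the
  factor for \<open>V\<close>.\<close>

lemma regular_cond_distr_cond_indep:
  assumes "prob_space P" and ci: "cond_indep P A U B V C (\<lambda>\<omega>. w (V \<omega>))"
    and k: "regular_cond_distr P C (\<lambda>\<omega>. w (V \<omega>)) A U k" and w[measurable]: "w \<in> B \<rightarrow>\<^sub>M C"
  shows "regular_cond_distr P B V A U (\<lambda>x. k (w x))"
proof -
  interpret prob_space P by fact
  let ?W = "\<lambda>\<omega>. w (V \<omega>)"
  have U[measurable]: "U \<in> P \<rightarrow>\<^sub>M A" and V[measurable]: "V \<in> P \<rightarrow>\<^sub>M B"
    and [measurable]: "k \<in> C \<rightarrow>\<^sub>M prob_algebra A"
    using ci k by (simp_all add: regular_cond_distr_def cond_indep_def)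
  have kw: "(\<lambda>x. k (w x)) \<in> B \<rightarrow>\<^sub>M prob_algebra A" by measurable
  let ?F = "vimage_algebra (space P) ?W C"
  have W_fun: "?W \<in> space P \<rightarrow> space C"
    using measurable_space[of ?W P C] by auto
  have sub: "subalgebra P ?F"
    unfolding subalgebra_def sets_vimage_algebra2[OF W_fun]
    by (auto intro: measurable_sets[of ?W P C])
  interpret S: finite_measure_subalgebra P ?F
    by unfold_locales (rule sub)
  have W': "?W \<in> ?F \<rightarrow>\<^sub>M C"
    by (rule measurable_vimage_algebra1[OF W_fun])
  have "measure P {\<omega>\<in>space P. V \<omega> \<in> S \<and> U \<omega> \<in> T} =
      (\<integral>\<omega>. indicator S (V \<omega>) * measure (k (w (V \<omega>))) T \<partial>P)"
    if S[measurable]: "S \<in> sets B" and T[measurable]: "T \<in> sets A" for S T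
  proof -
    let ?UV = "{\<omega>\<in>space P. U \<omega> \<in> T \<and> V \<omega> \<in> S}" and ?V = "{\<omega>\<in>space P. V \<omega> \<in> S}"
    let ?h = "\<lambda>\<omega>. measure (k (?W \<omega>)) T"
    have bound: "norm (?h \<omega>) \<le> 1" if "\<omega> \<in> space P" for \<omega>
      using measurable_space[OF \<open>k \<in> _\<close>, of "?W \<omega>"] W_fun that
      by (auto simp: space_prob_algebra intro: prob_space.prob_le_1)
    have hF: "?h \<in> borel_measurable ?F"
      using measurable_compose[OF W', of "\<lambda>x. measure (k x) T" borel] by simp
    have int: "integrable P (\<lambda>\<omega>. ?h \<omega> * indicator ?V \<omega>)"
      by (rule integrable_const_bound[where B=1])
        (use bound in \<open>auto simp: indicator_def\<close>)
    have "measure P {\<omega>\<in>space P. V \<omega> \<in> S \<and> U \<omega> \<in> T} = (\<integral>\<omega>. indicator ?UV \<omega> \<partial>P)"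
      by (simp add: Int_absorb2 Collect_restrict conj_commute)
    also have "\<dots> = (\<integral>\<omega>. real_cond_exp P ?F (indicator ?UV) \<omega> \<partial>P)"
      by (rule S.real_cond_exp_int(2)[symmetric])
        (auto intro!: integrable_const_bound[where B=1])
    also have "\<dots> = (\<integral>\<omega>. ?h \<omega> * real_cond_exp P ?F (indicator ?V) \<omega> \<partial>P)"
    proof (rule integral_cong_AE)
      \<comment> \<open>Independence splits the conditional probability into two factors. Only the
        first is identified with the kernel; the second remains a conditional expectation.\<close>
      have "AE \<omega> in P. cond_prob_given P C ?W ?UV \<omega> =
          cond_prob_given P C ?W {\<omega>\<in>space P. U \<omega> \<in> T} \<omega> * cond_prob_given P C ?W ?V \<omega>"
        using ci S T unfolding cond_indep_def by blast
      with cond_prob_given_eq_kernel[OF \<open>prob_space P\<close> k T]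
      show "AE \<omega> in P. real_cond_exp P ?F (indicator ?UV) \<omega> =
          ?h \<omega> * real_cond_exp P ?F (indicator ?V) \<omega>"
        by eventually_elim (simp add: cond_prob_given_def)
    qed simp_all
    \<comment> \<open>Since \<open>?h\<close> is measurable for \<open>?F\<close>, it acts as a
      constant under conditioning, so the conditional expectation of the indicator may be replaced
      by the indicator itself.\<close>
    also have "\<dots> = (\<integral>\<omega>. ?h \<omega> * indicator ?V \<omega> \<partial>P)"
      by (rule S.real_cond_exp_intg(2)[OF int hF]) simp
    also have "\<dots> = (\<integral>\<omega>. indicator S (V \<omega>) * ?h \<omega> \<partial>P)"
      by (rule Bochner_Integration.integral_cong) (auto simp: indicator_def)
    finally show ?thesis .
  qed
  then show ?thesis
    by (simp add: regular_cond_distr_iff_real[OF \<open>prob_space P\<close> V U kw])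
qed

section \<open>Disintegration of expectations over a finite outcome space\<close>

lemma integral_finite_discrete:
  fixes f :: "'b \<Rightarrow> real"
  assumes "finite_measure N" and sets: "sets N = Pow Y" and "finite Y"
  shows "(\<integral>y. f y \<partial>N) = (\<Sum>y\<in>Y. measure N {y} * f y)"
proof -
  interpret finite_measure N by fact
  have space: "space N = Y"
    using sets_eq_imp_space_eq[of N "count_space Y"] sets by simp
  have "(\<integral>y. f y \<partial>N) = (\<integral>y. (\<Sum>z\<in>Y. indicator {z} y * f z) \<partial>N)"
    by (rule Bochner_Integration.integral_cong)
      (use \<open>finite Y\<close> in \<open>auto simp: space indicator_def sum.delta if_distrib cong: if_cong\<close>)
  also have "\<dots> = (\<Sum>z\<in>Y. (\<integral>y. indicator {z} y * f z \<partial>N))"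
    by (rule Bochner_Integration.integral_sum) (auto simp: sets less_top[symmetric])
  also have "\<dots> = (\<Sum>z\<in>Y. measure N {z} * f z)"
    by (rule sum.cong) (auto simp: space)
  finally show ?thesis .
qed

text \<open>As \<open>V\<close> takes finitely many values, the integrand is a finite sum of
  products of an indicator of \<open>V = y\<close> with a function of \<open>U\<close> alone. Each
  summand is treated by a change of measure, for which the measurability of the sections
  \<open>\<lambda>x. \<phi> x y\<close> suffices.\<close>

lemma regular_cond_distr_integral:
  fixes \<phi> :: "'a \<Rightarrow> 'b \<Rightarrow> real"
  assumes "prob_space P" and K: "regular_cond_distr P A U (count_space Y) V K" and "finite Y"
    and \<phi>: "\<And>y. y \<in> Y \<Longrightarrow> (\<lambda>x. \<phi> x y) \<in> borel_measurable A"
    and int: "integrable P (\<lambda>\<omega>. \<phi> (U \<omega>) (V \<omega>))"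
  shows "integrable (distr P A U) (\<lambda>x. \<integral>y. \<phi> x y \<partial>K x)"
    and "(\<integral>\<omega>. \<phi> (U \<omega>) (V \<omega>) \<partial>P) = (\<integral>x. (\<integral>y. \<phi> x y \<partial>K x) \<partial>distr P A U)"
proof -
  interpret prob_space P by fact
  let ?D = "distr P A U"
  have U[measurable]: "U \<in> P \<rightarrow>\<^sub>M A" and V[measurable]: "V \<in> P \<rightarrow>\<^sub>M count_space Y"
    and K_meas[measurable]: "K \<in> A \<rightarrow>\<^sub>M prob_algebra (count_space Y)"
    using K by (simp_all add: regular_cond_distr_def)
  have K_space: "finite_measure (K x)" "sets (K x) = Pow Y" if "x \<in> space A" for x
    using measurable_space[OF K_meas that]
    by (auto simp: space_prob_algebra prob_space.finite_measure)
  have inner: "(\<integral>y. \<phi> x y \<partial>K x) = (\<Sum>y\<in>Y. measure (K x) {y} * \<phi> x y)" if "x \<in> space ?D" for x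
    using that by (intro integral_finite_discrete) (auto simp: K_space \<open>finite Y\<close>)
  have part: "integrable ?D (\<lambda>x. measure (K x) {y} * \<phi> x y) \<and>
      integrable P (\<lambda>\<omega>. indicator {y} (V \<omega>) * \<phi> (U \<omega>) y) \<and>
      (\<integral>\<omega>. indicator {y} (V \<omega>) * \<phi> (U \<omega>) y \<partial>P) = (\<integral>x. measure (K x) {y} * \<phi> x y \<partial>?D)"
    if y: "y \<in> Y" for y
  proof -
    have Y[measurable]: "{y} \<in> sets (count_space Y)" using y by simp
    have ind[measurable]: "(\<lambda>\<omega>. indicator {y} (V \<omega>) :: real) \<in> borel_measurable P"
      by (rule measurable_compose[OF V]) simp
    have Ky[measurable]: "(\<lambda>x. measure (K x) {y}) \<in> borel_measurable A"
      by measurable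
    note [measurable] = \<phi>[OF y]
    \<comment> \<open>\<open>?N\<close> is \<open>P\<close> restricted to the event
      \<open>V = y\<close>. By the defining identity of the kernel, the law of \<open>U\<close>
      under \<open>?N\<close> has density \<open>measure (K x) {y}\<close> with respect to the law
      of \<open>U\<close> under \<open>P\<close>; all transfers of integrals below go through this
      equality.\<close>
    let ?N = "density P (\<lambda>\<omega>. ennreal (indicator {y} (V \<omega>)))"
    have distr_eq: "distr ?N A U = density ?D (\<lambda>x. ennreal (measure (K x) {y}))"
    proof (rule measure_eqI)
      fix S assume "S \<in> sets (distr ?N A U)"
      then have S[measurable]: "S \<in> sets A" by simp
      have "emeasure (distr ?N A U) S = emeasure ?N (U -` S \<inter> space P)"
        by (subst emeasure_distr) simp_all
      also have "\<dots> = (\<integral>\<^sup>+\<omega>. ennreal (indicator {y} (V \<omega>)) * indicator (U -` S \<inter> space P) \<omega> \<partial>P)"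
        by (rule emeasure_density) simp_all
      also have "\<dots> = (\<integral>\<^sup>+\<omega>. indicator {\<omega>\<in>space P. U \<omega> \<in> S \<and> V \<omega> \<in> {y}} \<omega> \<partial>P)"
        by (rule nn_integral_cong) (auto simp: indicator_def)
      also have "\<dots> = emeasure P {\<omega>\<in>space P. U \<omega> \<in> S \<and> V \<omega> \<in> {y}}"
        by (rule nn_integral_indicator) measurable
      also have "\<dots> = (\<integral>\<^sup>+x\<in>S. emeasure (K x) {y} \<partial>?D)"
        using K S Y unfolding regular_cond_distr_def by blast
      also have "\<dots> = (\<integral>\<^sup>+x\<in>S. ennreal (measure (K x) {y}) \<partial>?D)"
        by (rule nn_integral_cong) (simp add: finite_measure.emeasure_eq_measure K_space)
      also have "\<dots> = emeasure (density ?D (\<lambda>x. ennreal (measure (K x) {y}))) S"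
        by (rule emeasure_density[symmetric]) simp_all
      finally show "emeasure (distr ?N A U) S = \<dots>" .
    qed simp
    have eq1: "integrable P (\<lambda>\<omega>. indicator {y} (V \<omega>) * \<phi> (U \<omega>) y) \<longleftrightarrow>
        integrable ?N (\<lambda>\<omega>. \<phi> (U \<omega>) y)"
      by (subst integrable_density) simp_all
    have eq2: "integrable ?N (\<lambda>\<omega>. \<phi> (U \<omega>) y) \<longleftrightarrow> integrable (distr ?N A U) (\<lambda>x. \<phi> x y)"
      by (subst integrable_distr_eq) simp_all
    have eq3: "integrable (distr ?N A U) (\<lambda>x. \<phi> x y) \<longleftrightarrow>
        integrable ?D (\<lambda>x. measure (K x) {y} * \<phi> x y)"
      unfolding distr_eq by (subst integrable_density) simp_all
    \<comment> \<open>The summand is dominated by the full integrand, and on the event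
      \<open>V = y\<close> the second argument can be frozen at \<open>y\<close>.\<close>
    have "integrable P (\<lambda>\<omega>. indicator {y} (V \<omega>) * \<phi> (U \<omega>) (V \<omega>))"
      by (rule Bochner_Integration.integrable_bound[OF int])
        (use int in \<open>auto simp: indicator_def\<close>)
    also have "(\<lambda>\<omega>. indicator {y} (V \<omega>) * \<phi> (U \<omega>) (V \<omega>)) = (\<lambda>\<omega>. indicator {y} (V \<omega>) * \<phi> (U \<omega>) y)"
      by (auto simp: indicator_def)
    finally have i: "integrable P (\<lambda>\<omega>. indicator {y} (V \<omega>) * \<phi> (U \<omega>) y)" .
    have "(\<integral>\<omega>. indicator {y} (V \<omega>) * \<phi> (U \<omega>) y \<partial>P) = (\<integral>\<omega>. \<phi> (U \<omega>) y \<partial>?N)"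
      by (subst integral_density) simp_all
    also have "\<dots> = (\<integral>x. \<phi> x y \<partial>distr ?N A U)"
      by (subst integral_distr) simp_all
    also have "\<dots> = (\<integral>x. measure (K x) {y} * \<phi> x y \<partial>?D)"
      unfolding distr_eq by (subst integral_density) simp_all
    finally show ?thesis
      using i eq1 eq2 eq3 by simp
  qed
  have "integrable ?D (\<lambda>x. \<Sum>y\<in>Y. measure (K x) {y} * \<phi> x y)"
    using part by auto
  moreover have "integrable ?D (\<lambda>x. \<integral>y. \<phi> x y \<partial>K x) \<longleftrightarrow>
      integrable ?D (\<lambda>x. \<Sum>y\<in>Y. measure (K x) {y} * \<phi> x y)"
    by (rule Bochner_Integration.integrable_cong[OF refl inner])
  ultimately show "integrable ?D (\<lambda>x. \<integral>y. \<phi> x y \<partial>K x)"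
    by simp
  have "(\<integral>\<omega>. \<phi> (U \<omega>) (V \<omega>) \<partial>P) = (\<integral>\<omega>. (\<Sum>y\<in>Y. indicator {y} (V \<omega>) * \<phi> (U \<omega>) y) \<partial>P)"
  proof (rule Bochner_Integration.integral_cong)
    fix \<omega> assume "\<omega> \<in> space P"
    then have "V \<omega> \<in> Y" using measurable_space[OF V] by simp
    then show "\<phi> (U \<omega>) (V \<omega>) = (\<Sum>y\<in>Y. indicator {y} (V \<omega>) * \<phi> (U \<omega>) y)"
      using \<open>finite Y\<close> by (simp add: indicator_def sum.delta if_distrib cong: if_cong)
  qed simp
  also have "\<dots> = (\<Sum>y\<in>Y. (\<integral>\<omega>. indicator {y} (V \<omega>) * \<phi> (U \<omega>) y \<partial>P))"
    using part by (intro Bochner_Integration.integral_sum) auto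
  also have "\<dots> = (\<Sum>y\<in>Y. (\<integral>x. measure (K x) {y} * \<phi> x y \<partial>?D))"
    using part by (intro sum.cong) auto
  also have "\<dots> = (\<integral>x. (\<Sum>y\<in>Y. measure (K x) {y} * \<phi> x y) \<partial>?D)"
    using part by (intro Bochner_Integration.integral_sum[symmetric]) auto
  also have "\<dots> = (\<integral>x. (\<integral>y. \<phi> x y \<partial>K x) \<partial>?D)"
    using inner by (intro Bochner_Integration.integral_cong) auto
  finally show "(\<integral>\<omega>. \<phi> (U \<omega>) (V \<omega>) \<partial>P) = (\<integral>x. (\<integral>y. \<phi> x y \<partial>K x) \<partial>?D)" .
qed

section \<open>Marginals of the conditional distributions in the coordinate family\<close>

text \<open>A coordinate with values 0 and 1 is the indicator of its being 1. This turns a marginal,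
  which is an integral, into the measure of a set, to which uniqueness of kernels applies.\<close>

lemma marginals_eq_measure_distr:
  assumes "Q \<in> space (prob_algebra (outcomes n))" and "i < n"
  shows "marginals n Q i = measure (distr Q (count_space {0, 1}) (\<lambda>y. y i)) {1}"
proof -
  interpret prob_space Q using assms by (simp add: space_prob_algebra)
  have sets: "sets Q = sets (outcomes n)" using assms by (simp add: space_prob_algebra)
  have space: "space Q = {..<n} \<rightarrow>\<^sub>E {0, 1}"
    using sets_eq_imp_space_eq[OF sets] by (simp add: outcomes_def)
  have m[measurable]: "(\<lambda>y. y i) \<in> Q \<rightarrow>\<^sub>M count_space {0, 1}"
    unfolding measurable_cong_sets[OF sets refl] outcomes_def
    using \<open>i < n\<close> by (auto simp: PiE_iff)
  have "(\<integral>y. y i \<partial>Q) = (\<integral>y. indicator ((\<lambda>y. y i) -` {1} \<inter> space Q) y \<partial>Q)"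
    by (rule Bochner_Integration.integral_cong)
      (use \<open>i < n\<close> in \<open>auto simp: space indicator_def PiE_iff\<close>)
  also have "\<dots> = measure Q ((\<lambda>y. y i) -` {1} \<inter> space Q)"
    by (simp add: Int_absorb2)
  also have "\<dots> = measure (distr Q (count_space {0, 1}) (\<lambda>y. y i)) {1}"
    by (rule measure_distr[symmetric]) simp_all
  finally show ?thesis
    using \<open>i < n\<close> by (simp add: marginals_def)
qed

text \<open>The function \<open>h\<close> comes from the kernel shared by all coordinates and is
  fixed before \<open>K\<close> is chosen. Hence the marginals of any two versions agree almost
  surely, each being compared with the same \<open>h\<close>.\<close>

lemma coordinate_family_marginals:
  assumes P: "P \<in> coordinate_family n M"
  obtains h where "h \<in> space M \<rightarrow> {0..1}"
    and "\<And>K. regular_cond_distr P (features n M) fst (outcomes n) snd K \<Longrightarrow>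
      AE x in distr P (features n M) fst. marginals n (K x) = (\<lambda>i\<in>{..<n}. h (x i))"
proof -
  have "prob_space P"
    using P by (simp add: coordinate_family_def space_prob_algebra)
  from P obtain k where
    k: "\<And>i. i < n \<Longrightarrow> regular_cond_distr P M (\<lambda>(x, y). x i) (count_space {0, 1}) (\<lambda>(x, y). y i) k"
    and ci: "\<And>i. i < n \<Longrightarrow> cond_indep P (count_space {0, 1}) (\<lambda>(x, y). y i) (features n M) fst
                 M (\<lambda>(x, y). x i)"
    by (auto simp: coordinate_family_def)
  \<comment> \<open>Truncation at 1 gives values in [0,1] before an index is fixed, when nothing is
    yet known about \<open>k\<close>. Wherever \<open>k x\<close> is a probability measure it
    changes nothing.\<close>
  define h where "h x = min 1 (measure (k x) {1})" for x
  show thesis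
  proof (rule that)
    show "h \<in> space M \<rightarrow> {0..1}"
      by (auto simp: h_def)
  next
    fix K assume K: "regular_cond_distr P (features n M) fst (outcomes n) snd K"
    let ?D = "distr P (features n M) fst"
    have K_meas: "K \<in> features n M \<rightarrow>\<^sub>M prob_algebra (outcomes n)"
      using K by (simp add: regular_cond_distr_def)
    have "AE x in ?D. marginals n (K x) i = h (x i)" if i: "i < n" for i
    proof -
      have proj: "(\<lambda>x. x i) \<in> features n M \<rightarrow>\<^sub>M M"
        unfolding features_def by (rule measurable_component_singleton) (use i in simp)
      have coord: "(\<lambda>y. y i) \<in> outcomes n \<rightarrow>\<^sub>M count_space {0, 1}"
        unfolding outcomes_def using i by (auto simp: PiE_iff)
      \<comment> \<open>Two kernels for the \<open>i\<close>-th outcome given the whole feature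
        vector: one from conditional independence, depending on \<open>x i\<close> only, the other
        by projecting \<open>K\<close>. Uniqueness then equates their masses at 1.\<close>
      have 1: "regular_cond_distr P (features n M) fst (count_space {0, 1}) (\<lambda>(x, y). y i)
          (\<lambda>x. k (x i))"
        using regular_cond_distr_cond_indep[OF \<open>prob_space P\<close> _ _ proj] ci[OF i] k[OF i]
        by (simp add: case_prod_beta')
      have 2: "regular_cond_distr P (features n M) fst (count_space {0, 1}) (\<lambda>(x, y). y i)
          (\<lambda>x. distr (K x) (count_space {0, 1}) (\<lambda>y. y i))"
        using regular_cond_distr_map[OF K coord] by (simp add: case_prod_beta')
      have k_meas: "k \<in> M \<rightarrow>\<^sub>M prob_algebra (count_space {0, 1})"
        using k[OF i] by (simp add: regular_cond_distr_def)
      have "AE x in ?D. measure (k (x i)) {1} =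
          measure (distr (K x) (count_space {0, 1}) (\<lambda>y. y i)) {1}"
        by (rule regular_cond_distr_unique[OF \<open>prob_space P\<close> 1 2]) simp
      with AE_space show ?thesis
      proof eventually_elim
        fix x assume x: "x \<in> space ?D" and
          eq: "measure (k (x i)) {1} = measure (distr (K x) (count_space {0, 1}) (\<lambda>y. y i)) {1}"
        have "prob_space (k (x i))"
          using measurable_space[OF k_meas] measurable_space[OF proj] x
          by (simp add: space_prob_algebra)
        then have "h (x i) = measure (k (x i)) {1}"
          by (simp add: h_def prob_space.prob_le_1)
        then show "marginals n (K x) i = h (x i)"
          using marginals_eq_measure_distr[OF measurable_space[OF K_meas] i, of x] eq x by simp
      qed
    qed
    \<comment> \<open>There are finitely many coordinates, so one null set serves for all of
      them.\<close>
    then have "AE x in ?D. \<forall>i\<in>{..<n}. marginals n (K x) i = h (x i)"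
      by (intro AE_finite_allI) auto
    then show "AE x in ?D. marginals n (K x) = (\<lambda>i\<in>{..<n}. h (x i))"
      by eventually_elim (auto simp: marginals_def fun_eq_iff restrict_def)
  qed
qed

section \<open>Propriety of the mapping form for coordinate-wise predictions\<close>

theorem theorem8:
  fixes M :: "'a measure" and n :: nat
    and F :: "(nat \<Rightarrow> real) measure set"
    and s :: "(nat \<Rightarrow> real) \<Rightarrow> (nat \<Rightarrow> real) \<Rightarrow> real"
  assumes "n \<ge> 1"
    and "F \<subseteq> space (prob_algebra (outcomes n))"
    and "marginals_proper n F s"
    and "\<And>P. P \<in> coordinate_family n M \<Longrightarrow>
           \<exists>K. regular_cond_distr P (features n M) fst (outcomes n) snd K \<and>
               (\<forall>x\<in>space (features n M). K x \<in> F)"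
  shows "mapping_marginals_proper n M (coordinate_family n M) (coordinate_wise n M) (mapping_form s)"
  unfolding mapping_marginals_proper_def
proof (intro ballI conjI impI)
  fix P assume P: "P \<in> coordinate_family n M"
  obtain K where K: "regular_cond_distr P (features n M) fst (outcomes n) snd K"
    and KF: "\<And>x. x \<in> space (features n M) \<Longrightarrow> K x \<in> F"
    using assms(4)[OF P] by auto
  obtain h where h: "h \<in> space M \<rightarrow> {0..1}"
    and marg: "\<And>K. regular_cond_distr P (features n M) fst (outcomes n) snd K \<Longrightarrow>
      AE x in distr P (features n M) fst. marginals n (K x) = (\<lambda>i\<in>{..<n}. h (x i))"
    using coordinate_family_marginals[OF P] by blast
  have coord: "(\<lambda>i\<in>{..<n}. h' (x i)) \<in> unit_cube n"
    if "h' \<in> space M \<rightarrow> {0..1}" "x \<in> space (features n M)" for h' x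
    using that by (auto simp: unit_cube_def features_def space_PiM PiE_iff Pi_iff)
  \<comment> \<open>The mapping induced by \<open>h\<close> lies in the cube at every feature
    vector, not just almost surely, and \<open>K\<close> witnesses that it represents the
    functional.\<close>
  have "(\<lambda>x. \<lambda>i\<in>{..<n}. h (x i)) \<in> mapping_marginals n M P"
    unfolding mapping_marginals_def using coord[OF h] K marg[OF K]
    by (auto simp: eq_commute)
  moreover have "(\<lambda>x. \<lambda>i\<in>{..<n}. h (x i)) \<in> coordinate_wise n M"
    using h by (auto simp: coordinate_wise_def)
  ultimately show "mapping_marginals n M P \<inter> coordinate_wise n M \<noteq> {}"
    by blast
  fix g f assume g: "g \<in> mapping_marginals n M P" and f: "f \<in> coordinate_wise n M"
    and int_f: "integrable P (\<lambda>\<omega>. mapping_form s \<omega> f)"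
    and int_g: "integrable P (\<lambda>\<omega>. mapping_form s \<omega> g)"
  let ?D = "distr P (features n M) fst" and ?Y = "{..<n} \<rightarrow>\<^sub>E {0, 1::real}"
  have "prob_space P" and sets_P: "sets P = sets (features n M \<Otimes>\<^sub>M outcomes n)"
    using P by (simp_all add: coordinate_family_def space_prob_algebra)
  \<comment> \<open>The version \<open>K'\<close> behind \<open>g\<close> may take values outside
    \<open>F\<close>, where propriety says nothing. Comparing both versions with \<open>h\<close>
    moves \<open>g\<close> over to \<open>K\<close>, all of whose values lie in
    \<open>F\<close>.\<close>
  have g_eq: "AE x in ?D. g x = marginals n (K x)"
  proof -
    from g obtain K' where K': "regular_cond_distr P (features n M) fst (outcomes n) snd K'"
      and "AE x in ?D. g x = marginals n (K' x)"
      by (auto simp: mapping_marginals_def)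
    from this(2) marg[OF K] marg[OF K'] show ?thesis
      by eventually_elim simp
  qed
  have f_cube: "f x \<in> unit_cube n" if "x \<in> space (features n M)" for x
    using f coord that by (auto simp: coordinate_wise_def)
  have "finite ?Y" by (intro finite_PiE) auto
  note K_cs = K[unfolded outcomes_def]
  \<comment> \<open>Neither \<open>s\<close> nor \<open>q\<close> is assumed measurable.
    Integrability of the mapping form supplies joint measurability in \<open>(x, y)\<close>, and
    fixing \<open>y\<close> gives the measurable section.\<close>
  have meas: "(\<lambda>x. s y (q x)) \<in> borel_measurable (features n M)"
    if "integrable P (\<lambda>\<omega>. mapping_form s \<omega> q)" "y \<in> ?Y" for q y
  proof -
    have "(\<lambda>\<omega>. mapping_form s \<omega> q) \<in> borel_measurable (features n M \<Otimes>\<^sub>M outcomes n)"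
      using borel_measurable_integrable[OF that(1)] by (simp cong: measurable_cong_sets add: sets_P)
    moreover have "(\<lambda>x. (x, y)) \<in> features n M \<rightarrow>\<^sub>M features n M \<Otimes>\<^sub>M outcomes n"
      by (rule measurable_Pair2') (use that(2) in \<open>simp add: outcomes_def\<close>)
    ultimately have "(\<lambda>x. mapping_form s (x, y) q) \<in> borel_measurable (features n M)"
      by (rule measurable_compose[rotated])
    then show ?thesis by (simp add: mapping_form_def)
  qed
  have disint: "integrable ?D (\<lambda>x. \<integral>y. s y (q x) \<partial>K x)"
    "(\<integral>\<omega>. mapping_form s \<omega> q \<partial>P) = (\<integral>x. (\<integral>y. s y (q x) \<partial>K x) \<partial>?D)"
    if q: "integrable P (\<lambda>\<omega>. mapping_form s \<omega> q)" for q
    using regular_cond_distr_integral[OF \<open>prob_space P\<close> K_cs \<open>finite ?Y\<close>, of "\<lambda>x y. s y (q x)"]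
      meas[OF q] q by (simp_all add: mapping_form_def case_prod_beta')
  have "(\<integral>x. (\<integral>y. s y (f x) \<partial>K x) \<partial>?D) \<le> (\<integral>x. (\<integral>y. s y (g x) \<partial>K x) \<partial>?D)"
  proof (rule integral_mono_AE)
    \<comment> \<open>For almost every \<open>x\<close> this is propriety of \<open>s\<close> at the
      distribution \<open>K x\<close>, with \<open>f x\<close> as the competing prediction and
      \<open>g x\<close> equal to the true marginals.\<close>
    show "AE x in ?D. (\<integral>y. s y (f x) \<partial>K x) \<le> (\<integral>y. s y (g x) \<partial>K x)"
      using g_eq AE_space
    proof eventually_elim
      fix x assume "g x = marginals n (K x)" and "x \<in> space ?D"
      then show "(\<integral>y. s y (f x) \<partial>K x) \<le> (\<integral>y. s y (g x) \<partial>K x)"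
        using assms(3) KF[of x] f_cube[of x] by (simp add: marginals_proper_def)
    qed
  qed (fact disint(1)[OF int_f] disint(1)[OF int_g])+
  then show "(\<integral>\<omega>. mapping_form s \<omega> f \<partial>P) \<le> (\<integral>\<omega>. mapping_form s \<omega> g \<partial>P)"
    by (simp add: disint(2) int_f int_g)
qed

end
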